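(* Let $a,b>0$ and $N\in\mathbb{N}$ (with $N\ge 1$). If $0\leq\nu\leq \frac{1}{2}$, then $$(\nu a+(1-\nu) b)^2+S_N(2\nu;ab,a^2)\leq \left(a^{\nu}b^{1-\nu}\right)^2+(1-\nu)^2(a-b)^2.$$ If $\frac{1}{2}\leq \nu\leq 1$, then $$(\nu a+(1-\nu) b)^2+S_N(2-2\nu;ab,b^2)\leq \left(a^{\nu}b^{1-\nu}\right)^2+\nu^2(a-b)^2.$$
   Context: $[x]$ denotes the greatest integer $\le x$. For $\nu\in[0,1]$ and $j\geq 1$ put $k_j(\nu)=[2^{j-1}\nu]$, $r_j(\nu)=[2^{j}\nu]$ and $s_j(\nu)=(-1)^{r_j(\nu)}2^{j-1}\nu+(-1)^{r_j(\nu)+1}\left[\frac{r_j(\nu)+1}{2}\right]$. For $a,b>0$, $\nu\in[0,1]$ and $N\ge 1$ define $$S_N(\nu;a,b)=\sum_{j=1}^{N}s_j(\nu)\left(\sqrt[2^j]{b^{2^{j-1}-k_j(\nu)}a^{k_j(\nu)}}-\sqrt[2^{j}]{a^{k_j(\nu)+1}b^{2^{j-1}-k_j(\nu)-1}}\right)^2 .$$ *)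

theory Defs
  imports Complex_Main
begin

text \<open>The index \<open>j\<close> ranges over \<open>j \<ge> 1\<close> throughout, so the truncated exponent \<open>j - 1\<close> is harmless.
  The floors are kept as integers: for \<open>\<nu> = 1\<close> one has \<open>k_idx j \<nu> = 2 ^ (j - 1)\<close>, and the exponent
  \<open>2 ^ (j - 1) - k_idx j \<nu> - 1\<close> below is \<open>-1\<close>.\<close>

definition k_idx :: "nat \<Rightarrow> real \<Rightarrow> int" where
  "k_idx j \<nu> = \<lfloor>2 ^ (j - 1) * \<nu>\<rfloor>"

definition r_idx :: "nat \<Rightarrow> real \<Rightarrow> int" where
  "r_idx j \<nu> = \<lfloor>2 ^ j * \<nu>\<rfloor>"

definition s_coef :: "nat \<Rightarrow> real \<Rightarrow> real" where
  "s_coef j \<nu> = (-1) powi (r_idx j \<nu>) * 2 ^ (j - 1) * \<nu>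
     + (-1) powi (r_idx j \<nu> + 1) * of_int \<lfloor>(of_int (r_idx j \<nu>) + 1) / (2::real)\<rfloor>"

definition S_sum :: "nat \<Rightarrow> real \<Rightarrow> real \<Rightarrow> real \<Rightarrow> real" where
  "S_sum N \<nu> a b = (\<Sum>j=1..N. s_coef j \<nu> *
     (root (2 ^ j) (b powi (2 ^ (j - 1) - k_idx j \<nu>) * a powi (k_idx j \<nu>))
      - root (2 ^ j) (a powi (k_idx j \<nu> + 1) * b powi (2 ^ (j - 1) - k_idx j \<nu> - 1)))\<^sup>2)"

end

theory Submission
  imports Defs "HOL-Analysis.Convex"
begin

text \<open>Put \<open>f x = a\<^sup>x b\<^sup>1\<^sup>-\<^sup>x\<close> and let \<open>L\<^sub>N\<close> be the piecewise linear interpolant of \<open>f\<close> at the dyadic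
  points \<open>m / 2\<^sup>N\<close>. Since \<open>f\<close> takes at a midpoint the geometric mean of its endpoint values, the
  drop \<open>L\<^sub>N - L\<^sub>N\<^sub>+\<^sub>1\<close> is a tent function times the square of a difference of square roots, which is
  the term of index \<open>N + 1\<close> of \<open>S\<^sub>N\<close>. Telescoping, \<open>S\<^sub>N = L\<^sub>0 - L\<^sub>N \<le> L\<^sub>0 - f\<close> by log-convexity
  of \<open>f\<close>: this refines Young's inequality. The claim for \<open>\<nu> \<le> 1/2\<close> is this refinement for
  \<open>2 \<nu>, a b, a\<^sup>2\<close> combined with
  \<open>2 a b \<le> a\<^sup>2\<^sup>\<nu> b\<^sup>2\<^sup>-\<^sup>2\<^sup>\<nu> + a\<^sup>2\<^sup>-\<^sup>2\<^sup>\<nu> b\<^sup>2\<^sup>\<nu>\<close>; swapping \<open>a\<close> and \<open>b\<close> gives the other half.\<close>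

definition wgm :: "real \<Rightarrow> real \<Rightarrow> real \<Rightarrow> real" where
  "wgm a b x = a powr x * b powr (1 - x)"

text \<open>Floor and \<open>frac\<close> of \<open>2 ^ N * \<nu>\<close> give the dyadic cell
  containing \<nu> and the relative position in it. At a grid point the right node has weight
  0.\<close>

definition dyadic_interp :: "(real \<Rightarrow> real) \<Rightarrow> nat \<Rightarrow> real \<Rightarrow> real" where
  "dyadic_interp f N \<nu> =
     (1 - frac (2 ^ N * \<nu>)) * f (of_int \<lfloor>2 ^ N * \<nu>\<rfloor> / 2 ^ N)
     + frac (2 ^ N * \<nu>) * f ((of_int \<lfloor>2 ^ N * \<nu>\<rfloor> + 1) / 2 ^ N)"

lemma wgm_pos: "a > 0 \<Longrightarrow> b > 0 \<Longrightarrow> wgm a b x > 0"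
  by (simp add: wgm_def)

text \<open>The logarithm of \<open>wgm a b\<close> is affine. The midpoint identity and the bound
  by chords both rest on this.\<close>

lemma wgm_affine:
  assumes "a > 0" "b > 0"
  shows "wgm a b ((1 - t) * x + t * y) = wgm a b x powr (1 - t) * wgm a b y powr t"
proof -
  have "wgm a b x powr (1 - t) * wgm a b y powr t
      = a powr (x * (1 - t)) * b powr ((1 - x) * (1 - t)) * (a powr (y * t) * b powr ((1 - y) * t))"
    using assms by (simp add: wgm_def powr_mult powr_powr)
  also have "\<dots> = a powr (x * (1 - t) + y * t) * b powr ((1 - x) * (1 - t) + (1 - y) * t)"
    by (simp add: powr_add)
  also have "\<dots> = wgm a b ((1 - t) * x + t * y)"
    unfolding wgm_def by (intro arg_cong2[where f = "(*)"] arg_cong2[where f = "(powr)"])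
      (auto simp: algebra_simps)
  finally show ?thesis ..
qed

lemma wgm_midpoint:
  assumes "a > 0" "b > 0"
  shows "wgm a b ((x + y) / 2) = sqrt (wgm a b x) * sqrt (wgm a b y)"
  using wgm_affine[OF assms, of "1/2" x y] wgm_pos[OF assms]
  by (simp add: powr_half_sqrt less_imp_le add_divide_distrib)

lemma wgm_le_dyadic_interp:
  assumes "a > 0" "b > 0"
  shows "wgm a b \<nu> \<le> dyadic_interp (wgm a b) N \<nu>"
proof -
  define t where "t = frac (2 ^ N * \<nu>)"
  define x where "x = of_int \<lfloor>2 ^ N * \<nu>\<rfloor> / (2::real) ^ N"
  define y where "y = (of_int \<lfloor>2 ^ N * \<nu>\<rfloor> + 1) / (2::real) ^ N"
  have t: "0 \<le> t" "t \<le> 1"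
    using frac_lt_1[of "2 ^ N * \<nu>"] by (auto simp: t_def)
  have "\<nu> = (1 - t) * x + t * y"
    by (simp add: t_def x_def y_def frac_def field_simps)
  then have "wgm a b \<nu> = wgm a b x powr (1 - t) * wgm a b y powr t"
    using wgm_affine[OF assms] by simp
  \<comment> \<open>Weighted AM-GM: the geometric interpolation between two nodes stays below the
    chord.\<close>
  also have "\<dots> \<le> (1 - t) * wgm a b x + t * wgm a b y"
    using t wgm_pos[OF assms] by (intro Youngs_inequality_0) auto
  finally show ?thesis
    by (simp add: dyadic_interp_def t_def x_def y_def)
qed

text \<open>The parity of \<open>r_idx\<close> tells which half of its cell \<nu> lies in, so the
  coefficient is the distance from \<open>2 ^ N * \<nu>\<close> to the nearest integer.\<close>

lemma s_coef_Suc: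
  "s_coef (Suc N) \<nu> = (if frac (2 ^ N * \<nu>) < 1/2 then frac (2 ^ N * \<nu>) else 1 - frac (2 ^ N * \<nu>))"
proof -
  define y where "y = 2 ^ N * \<nu>"
  define k where "k = \<lfloor>y\<rfloor>"
  have k: "of_int k \<le> y" "y < of_int k + 1" unfolding k_def by linarith+
  have r: "r_idx (Suc N) \<nu> = \<lfloor>2 * y\<rfloor>" by (simp add: r_idx_def y_def mult.assoc)
  show ?thesis
  proof (cases "frac y < 1/2")
    case True
    then have "r_idx (Suc N) \<nu> = 2 * k"
      unfolding r using k by (intro floor_unique) (auto simp: frac_def k_def[symmetric])
    moreover have "\<lfloor>(of_int (2 * k) + 1) / (2::real)\<rfloor> = k"
      by (intro floor_unique) auto
    ultimately show ?thesis using True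
      by (simp add: s_coef_def power_int_add power_int_mult y_def[symmetric] frac_def k_def)
  next
    case False
    then have "r_idx (Suc N) \<nu> = 2 * k + 1"
      unfolding r using k by (intro floor_unique) (auto simp: frac_def k_def[symmetric])
    moreover have "\<lfloor>(of_int (2 * k + 1) + 1) / (2::real)\<rfloor> = k + 1"
      by (intro floor_unique) auto
    ultimately show ?thesis using False
      by (simp add: s_coef_def power_int_add power_int_mult y_def[symmetric] frac_def k_def)
  qed
qed

text \<open>Splitting one square root off the root of order \<open>2 ^ Suc N\<close> leaves a node
  value. Allowing every integer \<open>m\<close> covers \<open>m = 2 ^ N + 1\<close>, the exponent
  -1 that occurs at \<nu> = 1.\<close>

lemma root_eq_sqrt_wgm:
  assumes "a > 0" "b > 0"
  shows "root (2 ^ Suc N) (a powi m * b powi (2 ^ N - m)) = sqrt (wgm a b (of_int m / 2 ^ N))"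
proof -
  have "root (2 ^ Suc N) (a powi m * b powi (2 ^ N - m))
      = sqrt (root (2 ^ N) (a powr of_int m * b powr (2 ^ N - of_int m)))"
    using assms powr_real_of_int'[of a m] powr_real_of_int'[of b "2 ^ N - m"]
    by (simp add: real_root_mult_exp sqrt_def)
  also have "root (2 ^ N) (a powr of_int m * b powr (2 ^ N - of_int m)) = wgm a b (of_int m / 2 ^ N)"
    using assms by (simp add: root_powr_inverse wgm_def powr_mult powr_powr diff_divide_distrib)
  finally show ?thesis .
qed

lemma dyadic_interp_diff:
  assumes "a > 0" "b > 0"
  shows "dyadic_interp (wgm a b) N \<nu> - dyadic_interp (wgm a b) (Suc N) \<nu>
    = s_coef (Suc N) \<nu> * (sqrt (wgm a b (of_int \<lfloor>2 ^ N * \<nu>\<rfloor> / 2 ^ N))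
        - sqrt (wgm a b ((of_int \<lfloor>2 ^ N * \<nu>\<rfloor> + 1) / 2 ^ N)))\<^sup>2"
proof -
  define y where "y = 2 ^ N * \<nu>"
  define k where "k = \<lfloor>y\<rfloor>"
  define t where "t = frac y"
  define P where "P = sqrt (wgm a b (of_int k / 2 ^ N))"
  define Q where "Q = sqrt (wgm a b ((of_int k + 1) / 2 ^ N))"
  have k: "of_int k \<le> y" "y < of_int k + 1" unfolding k_def by linarith+
  have y2: "2 ^ Suc N * \<nu> = 2 * y" by (simp add: y_def)
  have P: "wgm a b (of_int k / 2 ^ N) = P\<^sup>2" and Q: "wgm a b ((of_int k + 1) / 2 ^ N) = Q\<^sup>2"
    using wgm_pos[OF assms] by (auto simp: P_def Q_def less_imp_le)
  have "(of_int k / 2 ^ N + (of_int k + 1) / 2 ^ N) / 2 = (2 * of_int k + 1) / (2::real) ^ Suc N"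
    by (simp add: field_simps)
  then have PQ: "wgm a b ((2 * of_int k + 1) / 2 ^ Suc N) = P * Q"
    using wgm_midpoint[OF assms, of "of_int k / 2 ^ N" "(of_int k + 1) / 2 ^ N"]
    by (simp only: P_def Q_def)
  have L: "dyadic_interp (wgm a b) N \<nu> = (1 - t) * P\<^sup>2 + t * Q\<^sup>2"
    using P Q by (simp add: dyadic_interp_def y_def[symmetric] k_def t_def)
  have "dyadic_interp (wgm a b) N \<nu> - dyadic_interp (wgm a b) (Suc N) \<nu>
      = s_coef (Suc N) \<nu> * (P - Q)\<^sup>2"
  \<comment> \<open>The refined interpolant joins \<open>P\<^sup>2\<close> to \<open>P * Q\<close>
    on the left half and \<open>P * Q\<close> to \<open>Q\<^sup>2\<close> on the right half.
    Subtracting it from the chord leaves the square of \<open>P - Q\<close> times \<open>t\<close>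
    or \<open>1 - t\<close> respectively.\<close>
  proof (cases "t < 1/2")
    case True
    then have m: "\<lfloor>2 * y\<rfloor> = 2 * k"
      using k by (intro floor_unique) (auto simp: t_def frac_def k_def[symmetric])
    then have f: "frac (2 * y) = 2 * t" by (simp add: frac_def t_def k_def)
    have "of_int (2 * k) / 2 ^ Suc N = of_int k / (2::real) ^ N" by simp
    then have "dyadic_interp (wgm a b) (Suc N) \<nu> = (1 - 2 * t) * P\<^sup>2 + 2 * t * (P * Q)"
      unfolding dyadic_interp_def y2 m f using P PQ by simp
    then show ?thesis
      using True unfolding L s_coef_Suc y_def[symmetric] t_def[symmetric]
      by (simp add: algebra_simps power2_eq_square)
  next
    case False
    then have m: "\<lfloor>2 * y\<rfloor> = 2 * k + 1"
      using k by (intro floor_unique) (auto simp: t_def frac_def k_def[symmetric])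
    then have f: "frac (2 * y) = 2 * t - 1" by (simp add: frac_def t_def k_def)
    have "(of_int (2 * k + 1) + 1) / 2 ^ Suc N = (of_int k + 1) / (2::real) ^ N"
      by (simp add: field_simps)
    then have "dyadic_interp (wgm a b) (Suc N) \<nu> = (2 - 2 * t) * (P * Q) + (2 * t - 1) * Q\<^sup>2"
      unfolding dyadic_interp_def y2 m f using Q PQ by simp
    then show ?thesis
      using False unfolding L s_coef_Suc y_def[symmetric] t_def[symmetric]
      by (simp add: algebra_simps power2_eq_square)
  qed
  then show ?thesis by (simp add: P_def Q_def k_def y_def)
qed

lemma S_sum_eq_dyadic_interp:
  assumes "a > 0" "b > 0"
  shows "S_sum N \<nu> a b = dyadic_interp (wgm a b) 0 \<nu> - dyadic_interp (wgm a b) N \<nu>"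
proof -
  have "S_sum N \<nu> a b = (\<Sum>j<N. s_coef (Suc j) \<nu> *
      (sqrt (wgm a b (of_int \<lfloor>2 ^ j * \<nu>\<rfloor> / 2 ^ j))
        - sqrt (wgm a b ((of_int \<lfloor>2 ^ j * \<nu>\<rfloor> + 1) / 2 ^ j)))\<^sup>2)"
    unfolding S_sum_def One_nat_def sum.atLeast1_atMost_eq
  proof (intro sum.cong refl)
    fix j
    define k where "k = \<lfloor>2 ^ j * \<nu>\<rfloor>"
    have k: "k_idx (Suc j) \<nu> = k" by (simp add: k_idx_def k_def)
    show "s_coef (Suc j) \<nu> *
        (root (2 ^ Suc j) (b powi (2 ^ (Suc j - Suc 0) - k_idx (Suc j) \<nu>) * a powi k_idx (Suc j) \<nu>)
         - root (2 ^ Suc j)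
             (a powi (k_idx (Suc j) \<nu> + 1) * b powi (2 ^ (Suc j - Suc 0) - k_idx (Suc j) \<nu> - 1)))\<^sup>2
      = s_coef (Suc j) \<nu> * (sqrt (wgm a b (of_int \<lfloor>2 ^ j * \<nu>\<rfloor> / 2 ^ j))
         - sqrt (wgm a b ((of_int \<lfloor>2 ^ j * \<nu>\<rfloor> + 1) / 2 ^ j)))\<^sup>2"
      using root_eq_sqrt_wgm[OF assms, of j k] root_eq_sqrt_wgm[OF assms, of j "k + 1"]
      unfolding k k_def[symmetric] by (simp add: mult.commute diff_diff_eq)
  qed
  also have "\<dots> = (\<Sum>j<N. dyadic_interp (wgm a b) j \<nu> - dyadic_interp (wgm a b) (Suc j) \<nu>)"
    by (simp only: dyadic_interp_diff[OF assms])
  also have "\<dots> = dyadic_interp (wgm a b) 0 \<nu> - dyadic_interp (wgm a b) N \<nu>"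
    by (rule sum_lessThan_telescope')
  finally show ?thesis .
qed

lemma refined_Young:
  assumes "a > 0" "b > 0" "0 \<le> \<nu>" "\<nu> \<le> 1"
  shows "wgm a b \<nu> + S_sum N \<nu> a b \<le> \<nu> * a + (1 - \<nu>) * b"
proof -
  have "dyadic_interp (wgm a b) 0 \<nu> = \<nu> * a + (1 - \<nu>) * b"
  \<comment> \<open>At level 0 the nodes 0 and 1 carry \<open>b\<close> and \<open>a\<close>. At
    \<nu> = 1 the floor moves on to the cell from 1 to 2, of which only the left node
    counts.\<close>
  proof (cases "\<nu> = 1")
    case True
    then show ?thesis using assms by (simp add: dyadic_interp_def wgm_def)
  next
    case False
    with assms have "\<lfloor>\<nu>\<rfloor> = 0" by (intro floor_unique) auto
    then show ?thesis using assms by (simp add: dyadic_interp_def wgm_def frac_def)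
  qed
  then show ?thesis
    using S_sum_eq_dyadic_interp[OF assms(1,2), of N \<nu>] wgm_le_dyadic_interp[OF assms(1,2), of \<nu> N]
    by simp
qed

lemma square_mean_plus_S_sum_le:
  fixes a b \<nu> :: real
  assumes "a > 0" "b > 0" "0 \<le> \<nu>" "\<nu> \<le> 1 / 2"
  shows "(\<nu> * a + (1 - \<nu>) * b)\<^sup>2 + S_sum N (2 * \<nu>) (a * b) (a\<^sup>2)
    \<le> (a powr \<nu> * b powr (1 - \<nu>))\<^sup>2 + (1 - \<nu>)\<^sup>2 * (a - b)\<^sup>2"
proof -
  define p where "p = a powr \<nu> * b powr (1 - \<nu>)"
  define q where "q = a powr (1 - \<nu>) * b powr \<nu>"
  have "p * q = (a powr \<nu> * a powr (1 - \<nu>)) * (b powr \<nu> * b powr (1 - \<nu>))"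
    by (simp add: p_def q_def)
  also have "\<dots> = a * b"
    using assms by (simp flip: powr_add)
  \<comment> \<open>The refined Young inequality below produces \<open>q\<^sup>2\<close>, while the
    goal has \<open>p\<^sup>2\<close>; AM-GM trades one for the other.\<close>
  finally have "2 * (a * b) \<le> p\<^sup>2 + q\<^sup>2"
    using sum_squares_bound[of p q] by simp
  moreover have "wgm (a * b) (a\<^sup>2) (2 * \<nu>) = q\<^sup>2"
  proof -
    have "wgm (a * b) (a\<^sup>2) (2 * \<nu>) = (a powr (2 * \<nu>) * a powr (2 * (1 - 2 * \<nu>))) * b powr (2 * \<nu>)"
      using assms by (simp add: wgm_def powr_mult powr_powr flip: powr_numeral)
    also have "a powr (2 * \<nu>) * a powr (2 * (1 - 2 * \<nu>)) = a powr (2 * (1 - \<nu>))"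
      by (simp add: algebra_simps flip: powr_add)
    finally show ?thesis
      using assms by (simp add: q_def power_mult_distrib powr_power mult.commute)
  qed
  ultimately have "S_sum N (2 * \<nu>) (a * b) (a\<^sup>2)
      \<le> 2 * \<nu> * (a * b) + (1 - 2 * \<nu>) * a\<^sup>2 + p\<^sup>2 - 2 * (a * b)"
    using refined_Young[of "a * b" "a\<^sup>2" "2 * \<nu>" N] assms by simp
  moreover have "(\<nu> * a + (1 - \<nu>) * b)\<^sup>2 + (2 * \<nu> * (a * b) + (1 - 2 * \<nu>) * a\<^sup>2 - 2 * (a * b))
      = (1 - \<nu>)\<^sup>2 * (a - b)\<^sup>2"
    by algebra
  ultimately show ?thesis
    unfolding p_def by linarith
qed

theorem proposition2p6:
  fixes a b \<nu> :: real and N :: nat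
  assumes "a > 0" and "b > 0" and "N \<ge> 1"
  shows "(0 \<le> \<nu> \<and> \<nu> \<le> 1 / 2 \<longrightarrow>
           (\<nu> * a + (1 - \<nu>) * b)\<^sup>2 + S_sum N (2 * \<nu>) (a * b) (a\<^sup>2)
             \<le> (a powr \<nu> * b powr (1 - \<nu>))\<^sup>2 + (1 - \<nu>)\<^sup>2 * (a - b)\<^sup>2)
       \<and> (1 / 2 \<le> \<nu> \<and> \<nu> \<le> 1 \<longrightarrow>
           (\<nu> * a + (1 - \<nu>) * b)\<^sup>2 + S_sum N (2 - 2 * \<nu>) (a * b) (b\<^sup>2)
             \<le> (a powr \<nu> * b powr (1 - \<nu>))\<^sup>2 + \<nu>\<^sup>2 * (a - b)\<^sup>2)"
  \<comment> \<open>Swapping \<open>a\<close> and \<open>b\<close> goes with replacing \<nu> by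
    \<open>1 - \<nu>\<close>: both means are unchanged, and \<open>2 * \<nu>\<close> becomes
    \<open>2 - 2 * \<nu>\<close>.\<close>
  using square_mean_plus_S_sum_le[OF assms(1,2), of \<nu> N]
    square_mean_plus_S_sum_le[OF assms(2,1), of "1 - \<nu>" N]
  by (auto simp: algebra_simps power2_commute[of b a])

end
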